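(* Let $\tau_x>0$, let $k_x^*>0$, and let $p\ge 1$ be an integer. Consider the equidistant knot B-spline basis function of order $p$, centered at the origin, with support $[-\alpha_x,\alpha_x]$, where $$\alpha_x=\frac{\sqrt{3p}\,\tau_x}{k_x^*}.$$ Let $\rho(x)=\frac{1}{\sqrt{2\pi}\,\sigma}\exp\left(-\frac{x^2}{2\sigma^2}\right)$ be the Gaussian function whose first four moments are the same as those of this B-spline (normalized to have integral $1$). Then $k_x^*$ falls $\tau_x$ standard deviations into the tail of the spectrum of $\rho$ in the frequency domain; that is, the Fourier transform $\widehat{\rho}(\omega)$ is of the form $\exp\left(-\frac{\omega^2}{2\sigma_\omega^2}\right)$ with $\sigma_\omega>0$, and $$k_x^*=\tau_x\,\sigma_\omega .$$
   Context: The equidistant knot B-spline of order $p$ (piecewise polynomial degree $p-1$) with knot spacing $h$, centered at the origin, is the B-spline $B^{p,h}$ given by the Cox-de Boor recursion on the $p+1$ knots $-\frac{ph}{2}+sh$, $s=0,\dots,p$, with partition-of-unity normalization. Equivalently, $B^{1,h}$ is the indicator function of $[-h/2,h/2)$ and $B^{p,h}=\frac{1}{h}B^{p-1,h}*B^{1,h}$ for $p\ge2$, where $*$ is convolution on $\mathbb{R}$. Its support is $[-\alpha_x,\alpha_x]$ with $\alpha_x=ph/2$ (so prescribing $\alpha_x$ and $p$ determines $h=2\alpha_x/p$), its integral is $h$, and its normalization is $\frac1hB^{p,h}$. "First four moments" means the moments $\int x^j f(x)\,dx$ of orders $j=0,1,2,3$. The Fourier transform is $\widehat{f}(\omega)=\int_{\mathbb{R}}f(x)e^{-i\omega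 x}\,dx$. In the paper $k_x^*$ is a critical frequency, separating the signal-dominant region $(-k_x^*,k_x^* )$ of the spectrum of noisy data from the noise-dominant region; here it is simply a given positive real number. The "standard deviation" of the spectrum $\widehat\rho$ means the parameter $\sigma_\omega$ in $\widehat{\rho}(\omega)=\exp(-\omega^2/(2\sigma_\omega^2))$. *)

theory Defs
  imports "HOL-Probability.Probability"
begin

text \<open>
  \<open>cox_de_boor t p i\<close> is the B-spline of order \<open>p\<close> (degree \<open>p - 1\<close>) on the knots
  \<open>t i, \<dots>, t (i + p)\<close>, normalised so that the B-splines of a fixed order form a partition of
  unity. Orders start at 1; the value at order 0 is a dummy.
\<close>

fun cox_de_boor :: "(nat \<Rightarrow> real) \<Rightarrow> nat \<Rightarrow> nat \<Rightarrow> real \<Rightarrow> real" where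
  "cox_de_boor t 0 i x = 0"
| "cox_de_boor t (Suc 0) i x = (if t i \<le> x \<and> x < t (i + 1) then 1 else 0)"
| "cox_de_boor t (Suc (Suc k)) i x =
     (x - t i) / (t (i + Suc k) - t i) * cox_de_boor t (Suc k) i x
     + (t (i + Suc (Suc k)) - x) / (t (i + Suc (Suc k)) - t (i + 1)) * cox_de_boor t (Suc k) (i + 1) x"

definition equidistant_knots :: "nat \<Rightarrow> real \<Rightarrow> nat \<Rightarrow> real" where
  "equidistant_knots p h s = - (real p * h / 2) + real s * h"

definition bspline :: "nat \<Rightarrow> real \<Rightarrow> real \<Rightarrow> real" where
  "bspline p h = cox_de_boor (equidistant_knots p h) p 0"

text \<open>The partition-of-unity B-spline has integral \<open>h\<close>, so this one has integral 1.\<close>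

definition normalized_bspline :: "nat \<Rightarrow> real \<Rightarrow> real \<Rightarrow> real" where
  "normalized_bspline p h x = bspline p h x / h"

definition support :: "(real \<Rightarrow> real) \<Rightarrow> real set" where
  "support f = closure {x. f x \<noteq> 0}"

definition moment :: "nat \<Rightarrow> (real \<Rightarrow> real) \<Rightarrow> real" where
  "moment j f = (LINT x|lborel. x ^ j * f x)"

definition fourier :: "(real \<Rightarrow> real) \<Rightarrow> real \<Rightarrow> complex" where
  "fourier f \<omega> = (LINT x|lborel. complex_of_real (f x) * exp (- (\<i> * complex_of_real \<omega> * complex_of_real x)))"

end

theory Submission
  imports Defs
begin

text \<open>
  The variance of a normalised B-spline of order \<open>p\<close> with knot spacing \<open>h\<close> is \<open>p h\<^sup>2 / 12\<close>.
  Since \<open>\<alpha> = p h / 2\<close>, matching second moments gives \<open>\<sigma>\<^sup>2 = \<alpha>\<^sup>2 / (3 p) = (\<tau> / k)\<^sup>2\<close>, and the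
  spectrum of the Gaussian has standard deviation \<open>1 / \<sigma> = k / \<tau>\<close>.

  The variance comes from the weak form of the differentiation formula,
  \<open>h \<integral> q' B\<^sub>p\<^sub>+\<^sub>1\<^sub>,\<^sub>i = \<integral> q (B\<^sub>p\<^sub>,\<^sub>i\<^sub>+\<^sub>1 - B\<^sub>p\<^sub>,\<^sub>i)\<close> for polynomials \<open>q\<close>. It follows
  from the fundamental theorem of calculus at order 0 and the Cox-de Boor recursion by pure
  algebra. For \<open>q = (x - t\<^sub>i)\<^sup>j\<close> it becomes a recursion in \<open>p\<close> for the moments about the first knot.
\<close>

section \<open>Splines on uniform knots: recursion, support and translation\<close>

abbreviation uniform_knots :: "real \<Rightarrow> real \<Rightarrow> nat \<Rightarrow> real" where
  "uniform_knots c h \<equiv> \<lambda>s. c + real s * h"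

abbreviation uspline :: "real \<Rightarrow> real \<Rightarrow> nat \<Rightarrow> nat \<Rightarrow> real \<Rightarrow> real" where
  "uspline c h \<equiv> cox_de_boor (uniform_knots c h)"

text \<open>
  At order 0 the spline divided by \<open>h\<close> degenerates to the point mass at its knot. With this
  convention the recursions below start at order 0.
\<close>

definition spline_integral :: "real \<Rightarrow> real \<Rightarrow> nat \<Rightarrow> nat \<Rightarrow> real poly \<Rightarrow> real" where
  "spline_integral c h p i q =
     (if p = 0 then h * poly q (c + real i * h)
      else (LINT x|lborel. poly q x * uspline c h p i x))"

text \<open>On uniform knots both denominators of the Cox-de Boor recursion equal
  \<open>real (Suc n) * h\<close>. Clearing them leaves linear factors, which can later be absorbed
  into a polynomial.\<close>

lemma uspline_rec:
  assumes "h > 0"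
  shows "uspline c h (Suc (Suc n)) i x * (real (Suc n) * h) =
    (x - (c + real i * h)) * uspline c h (Suc n) i x
    + (c + real (i + Suc (Suc n)) * h - x) * uspline c h (Suc n) (i + 1) x"
proof -
  have "real (Suc n) * h \<noteq> 0" using assms by simp
  moreover have "c + real (i + Suc n) * h - (c + real i * h) = real (Suc n) * h"
    "c + real (i + Suc (Suc n)) * h - (c + real (i + 1) * h) = real (Suc n) * h"
    by (simp_all add: algebra_simps)
  ultimately show ?thesis
    unfolding cox_de_boor.simps(3) by (simp only: distrib_right) simp
qed

lemma uspline_outside:
  assumes "h > 0" and "x < c + real i * h \<or> x \<ge> c + real (i + p) * h"
  shows "uspline c h p i x = 0"
  using assms(2)
proof (induction "uniform_knots c h" p i x rule: cox_de_boor.induct)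
  case (3 n i x)
  have "x < c + real i * h \<or> x \<ge> c + real (i + Suc n) * h \<or> x \<ge> c + real (i + Suc (Suc n)) * h"
    "x < c + real (i + 1) * h \<or> x \<ge> c + real (i + 1 + Suc n) * h"
    using 3(3) assms(1) by (auto simp: algebra_simps)
  moreover have "x \<ge> c + real (i + Suc n) * h" if "x \<ge> c + real (i + Suc (Suc n)) * h"
    using that assms(1) by (auto simp: algebra_simps)
  ultimately have "uspline c h (Suc n) i x = 0" "uspline c h (Suc n) (i + 1) x = 0"
    using 3(1,2) by blast+
  then show ?case by simp
qed auto

text \<open>On the last knot interval the left summand of the recursion vanishes, so positivity
  passes through the right summand alone. This interval is enough to locate the right end of the
  support.\<close>

lemma uspline_pos:
  assumes "h > 0" and "c + real (i + n) * h \<le> x" and "x < c + real (i + Suc n) * h"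
  shows "uspline c h (Suc n) i x > 0"
  using assms(2,3)
proof (induction n arbitrary: i)
  case (Suc n)
  have *: "real (Suc n) * h > 0" using assms(1) by simp
  have "uspline c h (Suc n) i x = 0"
    using uspline_outside[OF assms(1)] Suc.prems by blast
  moreover have "uspline c h (Suc n) (i + 1) x > 0"
    by (rule Suc.IH) (use Suc.prems in simp_all)
  ultimately have "uspline c h (Suc (Suc n)) i x * (real (Suc n) * h) > 0"
    unfolding uspline_rec[OF assms(1)] using Suc.prems by simp
  then show ?case
    using * by (simp only: zero_less_mult_pos2)
qed simp

lemma support_bspline:
  assumes "h > 0" and "p \<ge> 1" and "support (bspline p h) = {- \<alpha>..\<alpha>}"
  shows "\<alpha> = real p * h / 2"
proof (rule antisym)
  let ?a = "real p * h / 2"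
  have B: "bspline p h = uspline (- ?a) h p 0"
    unfolding bspline_def equidistant_knots_def by simp
  obtain n where n: "p = Suc n" using assms(2) by (cases p) auto
  have a: "?a > 0" using assms by simp
  have "{?a - h<..<?a} \<subseteq> {x. bspline p h x \<noteq> 0}"
  proof
    fix x assume x: "x \<in> {?a - h<..<?a}"
    have "uspline (- ?a) h (Suc n) 0 x > 0"
      by (rule uspline_pos[OF assms(1)]) (use x n in \<open>auto simp: field_simps\<close>)
    then have "uspline (- ?a) h p 0 x > 0"
      using n by (simp only:)
    then show "x \<in> {x. bspline p h x \<noteq> 0}"
      unfolding B by (intro CollectI) (rule less_imp_neq[symmetric])
  qed
  then have "closure {?a - h<..<?a} \<subseteq> {- \<alpha>..\<alpha>}"
    using closure_mono assms(3) unfolding support_def by metis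
  then have "?a \<in> {- \<alpha>..\<alpha>}" 
    by (rule subsetD) (use assms(1) in simp)
  then show "?a \<le> \<alpha>" by simp
  have "{x. bspline p h x \<noteq> 0} \<subseteq> {- ?a..?a}"
  proof
    fix x assume "x \<in> {x. bspline p h x \<noteq> 0}"
    then have "\<not> (x < - ?a + real 0 * h \<or> x \<ge> - ?a + real (0 + p) * h)"
      using uspline_outside[OF assms(1)] unfolding B by blast
    then show "x \<in> {- ?a..?a}" by (simp add: mult.commute[of h])
  qed
  then have "{- \<alpha>..\<alpha>} \<subseteq> {- ?a..?a}"
    using closure_minimal[OF _ closed_atLeastAtMost] assms(3) unfolding support_def by metis
  \<comment> \<open>An interval contains its right end only if it is nonempty;
    \<open>\<alpha> > 0\<close> comes from the inequality just shown.\<close>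
  moreover have "\<alpha> \<in> {- \<alpha>..\<alpha>}" using \<open>?a \<le> \<alpha>\<close> a by simp
  ultimately show "\<alpha> \<le> ?a" by auto
qed

text \<open>The recursion sees only differences of knots and argument, and these do not change when
  index and argument advance together.\<close>

lemma uspline_shift: "uspline c h p (i + 1) (x + h) = uspline c h p i x"
proof (induction "uniform_knots c h" p i x rule: cox_de_boor.induct)
  case (3 n i x)
  have "x + h - uniform_knots c h (i + 1) = x - uniform_knots c h i"
    "uniform_knots c h (i + 1 + m) - (x + h) = uniform_knots c h (i + m) - x"
    "uniform_knots c h (i + 1 + m) - uniform_knots c h (i + 1)
      = uniform_knots c h (i + m) - uniform_knots c h i"
    "uniform_knots c h (i + 1 + m) - uniform_knots c h (i + 1 + 1)
      = uniform_knots c h (i + m) - uniform_knots c h (i + 1)" for m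
    by (simp_all add: algebra_simps)
  then show ?case
    unfolding cox_de_boor.simps(3) 3(1) 3(2) by (simp only:)
qed (auto simp: algebra_simps)

section \<open>Integrals of polynomials against splines, and the weak differentiation
  formula\<close>

lemma integrable_poly_uspline:
  assumes "h > 0"
  shows "integrable lborel (\<lambda>x. poly q x * uspline c h p i x)"
proof (cases p)
  case (Suc n)
  have "integrable lborel (\<lambda>x. poly q x * uspline c h (Suc n) i x)"
  proof (induction n arbitrary: q i)
    case 0
    have "set_integrable lborel {c + real i * h..c + real (i + 1) * h} (poly q)"
      by (intro borel_integrable_atLeastAtMost' continuous_intros)
    then have "set_integrable lborel {c + real i * h..<c + real (i + 1) * h} (poly q)"
      by (rule set_integrable_subset) auto
    then show ?case
      unfolding set_integrable_def
      by (rule Bochner_Integration.integrable_cong[THEN iffD1, rotated -1])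
         (auto simp: indicator_def)
  next
    case (Suc n)
    have "integrable lborel (\<lambda>x. poly (q * [:- (c + real i * h), 1:]) x * uspline c h (Suc n) i x
        + poly (q * [:c + real (i + Suc (Suc n)) * h, - 1:]) x * uspline c h (Suc n) (i + 1) x)"
      by (intro Bochner_Integration.integrable_add Suc.IH)
    also have "(\<lambda>x. poly (q * [:- (c + real i * h), 1:]) x * uspline c h (Suc n) i x
        + poly (q * [:c + real (i + Suc (Suc n)) * h, - 1:]) x * uspline c h (Suc n) (i + 1) x)
      = (\<lambda>x. (real (Suc n) * h) * (poly q x * uspline c h (Suc (Suc n)) i x))"
      (is "?f = ?g")
    proof
      fix x
      have "?g x = poly q x * (uspline c h (Suc (Suc n)) i x * (real (Suc n) * h))"
        by (simp only: mult_ac)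
      then show "?f x = ?g x"
        unfolding uspline_rec[OF assms] by (simp add: algebra_simps del: cox_de_boor.simps)
    qed
    finally show ?case
      using assms by (simp only: integrable_mult_left_iff) simp
  qed
  then show ?thesis using Suc by simp
qed simp

lemma spline_integral_add:
  "h > 0 \<Longrightarrow> spline_integral c h p i (q + r) = spline_integral c h p i q + spline_integral c h p i r"
  unfolding spline_integral_def
  by (simp add: distrib_right distrib_left Bochner_Integration.integral_add integrable_poly_uspline)

lemma spline_integral_smult:
  "spline_integral c h p i (smult a q) = a * spline_integral c h p i q"
  unfolding spline_integral_def by (simp add: mult.assoc)

text \<open>The Cox-de Boor recursion is integrated with its linear factors moved into the
  polynomial. At order 0 both sides are 0, since each factor vanishes at the knot carrying the point
  mass.\<close>

lemma spline_integral_rec: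
  assumes "h > 0"
  shows "(real p * h) * spline_integral c h (Suc p) i q =
    spline_integral c h p i (q * [:- (c + real i * h), 1:])
    + spline_integral c h p (i + 1) (q * [:c + real (i + Suc p) * h, - 1:])"
proof (cases p)
  case 0
  then show ?thesis by (simp add: spline_integral_def algebra_simps)
next
  case (Suc n)
  have "(real p * h) * spline_integral c h (Suc p) i q
      = (LINT x|lborel. (real p * h) * (poly q x * uspline c h (Suc p) i x))"
    unfolding spline_integral_def by simp
  also have "\<dots> = (LINT x|lborel. poly (q * [:- (c + real i * h), 1:]) x * uspline c h p i x
        + poly (q * [:c + real (i + Suc p) * h, - 1:]) x * uspline c h p (i + 1) x)"
  proof (rule Bochner_Integration.integral_cong[OF refl])
    fix x
    have "(real p * h) * (poly q x * uspline c h (Suc p) i x)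
        = poly q x * (uspline c h (Suc (Suc n)) i x * (real (Suc n) * h))"
      unfolding Suc by (simp only: mult_ac)
    then show "(real p * h) * (poly q x * uspline c h (Suc p) i x)
      = poly (q * [:- (c + real i * h), 1:]) x * uspline c h p i x
        + poly (q * [:c + real (i + Suc p) * h, - 1:]) x * uspline c h p (i + 1) x"
      unfolding uspline_rec[OF assms] Suc by (simp add: algebra_simps del: cox_de_boor.simps)
  qed
  also have "\<dots> = spline_integral c h p i (q * [:- (c + real i * h), 1:])
    + spline_integral c h p (i + 1) (q * [:c + real (i + Suc p) * h, - 1:])"
    unfolding spline_integral_def using Suc
    by (simp only: Bochner_Integration.integral_add[OF integrable_poly_uspline[OF assms]
          integrable_poly_uspline[OF assms]]) simp
  finally show ?thesis .
qed

lemma spline_integral_pderiv: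
  assumes "h > 0"
  shows "h * spline_integral c h (Suc p) i (pderiv q)
    = spline_integral c h p (i + 1) q - spline_integral c h p i q"
proof (induction p arbitrary: i q)
  case 0
  let ?a = "c + real i * h" and ?b = "c + real (i + 1) * h"
  have "spline_integral c h (Suc 0) i (pderiv q)
      = (LINT x|lborel. indicator {?a..?b} x *\<^sub>R poly (pderiv q) x)"
    unfolding spline_integral_def if_not_P[OF Suc_not_Zero]
  proof (rule integral_cong_AE)
    have [measurable]: "poly (pderiv q) \<in> borel_measurable borel"
      by (intro borel_measurable_continuous_onI continuous_intros)
    show "(\<lambda>x. indicator {?a..?b} x *\<^sub>R poly (pderiv q) x) \<in> borel_measurable lborel"
      by measurable
    show "AE x in lborel. poly (pderiv q) x * uspline c h (Suc 0) i x
        = indicator {?a..?b} x *\<^sub>R poly (pderiv q) x"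
      \<comment> \<open>The order 1 spline lives on a half-open interval, so the integrands can
        differ only at \<open>?b\<close>.\<close>
      using AE_lborel_singleton[of ?b] by eventually_elim (auto simp: indicator_def)
  qed (use integrable_poly_uspline[OF assms] in blast)
  also have "\<dots> = poly q ?b - poly q ?a"
  proof (rule integral_FTC_Icc)
    show "(poly q has_vector_derivative poly (pderiv q) x) (at x within {?a..?b})" for x
      by (simp add: has_real_derivative_iff_has_vector_derivative[symmetric]
          has_field_derivative_at_within poly_DERIV)
  qed (use assms in \<open>auto intro!: continuous_intros simp: algebra_simps\<close>)
  finally show ?case by (simp only: right_diff_distrib) (simp add: spline_integral_def)
next
  case (Suc p)
  let ?I = "spline_integral c h" and ?s = "c + real i * h" and ?T = "c + real (i + Suc (Suc p)) * h"
  \<comment> \<open>The product rule puts each linear factor under the derivative, so that the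
    induction hypothesis applies; the slopes 1 and -1 leave the corrections -q and +q.\<close>
  have l: "pderiv q * [:- ?s, 1:] = pderiv (q * [:- ?s, 1:]) + smult (- 1) q"
    "pderiv q * [:?T, - 1:] = pderiv (q * [:?T, - 1:]) + q"
    unfolding pderiv_mult by (simp_all add: pderiv_pCons)
  \<comment> \<open>The linear factors are moved to the knots that the recursion one order lower
    requires at the indices \<open>i + 1\<close> and \<open>i\<close>. Both moves cost
    \<open>smult h q\<close>, and these corrections later cancel.\<close>
  have s: "q * [:- ?s, 1:] = q * [:- (c + real (i + 1) * h), 1:] + smult h q"
    "q * [:?T, - 1:] = q * [:c + real (i + Suc p) * h, - 1:] + smult h q"
    by (simp_all add: algebra_simps flip: smult_add_left)
  have "(real (Suc p) * h) * (h * ?I (Suc (Suc p)) i (pderiv q))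
    = h * ((real (Suc p) * h) * ?I (Suc (Suc p)) i (pderiv q))" by (simp only: mult_ac)
  also have "\<dots> = h * ?I (Suc p) i (pderiv (q * [:- ?s, 1:])) - h * ?I (Suc p) i q
      + h * ?I (Suc p) (i + 1) (pderiv (q * [:?T, - 1:])) + h * ?I (Suc p) (i + 1) q"
    unfolding spline_integral_rec[OF assms] l spline_integral_add[OF assms] spline_integral_smult
    by (simp add: algebra_simps)
  also have "\<dots> = ?I p (i + 1) (q * [:- ?s, 1:]) - ?I p i (q * [:- ?s, 1:]) - h * ?I (Suc p) i q
      + ?I p (i + 1 + 1) (q * [:?T, - 1:]) - ?I p (i + 1) (q * [:?T, - 1:])
      + h * ?I (Suc p) (i + 1) q"
    unfolding Suc.IH by simp
  also have "?I p (i + 1) (q * [:- ?s, 1:]) =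
      ?I p (i + 1) (q * [:- (c + real (i + 1) * h), 1:]) + h * ?I p (i + 1) q"
    unfolding s(1) by (simp only: spline_integral_add[OF assms] spline_integral_smult)
  also have "?I p (i + 1) (q * [:?T, - 1:]) =
      ?I p (i + 1) (q * [:c + real (i + Suc p) * h, - 1:]) + h * ?I p (i + 1) q"
    unfolding s(2) by (simp only: spline_integral_add[OF assms] spline_integral_smult)
  finally have "(real (Suc p) * h) * (h * ?I (Suc (Suc p)) i (pderiv q)) =
      (real p * h) * ?I (Suc p) (i + 1) q - (real p * h) * ?I (Suc p) i q
      + h * ?I (Suc p) (i + 1) q - h * ?I (Suc p) i q"
    using spline_integral_rec[OF assms, of p c i q] spline_integral_rec[OF assms, of p c "i + 1" q]
    by simp
  also have "\<dots> = (real (Suc p) * h) * (?I (Suc p) (i + 1) q - ?I (Suc p) i q)"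
    by (simp add: algebra_simps)
  finally show ?case
    using assms by simp
qed

text \<open>Substituting x + h for x transfers the translation from the spline to the polynomial, so
  the moment recursion stays at one index.\<close>

lemma spline_integral_shift:
  "spline_integral c h p (i + 1) q = spline_integral c h p i (pcompose q [:h, 1:])"
proof (cases "p = 0")
  case False
  have "(LINT x|lborel. poly q x * uspline c h p (i + 1) x)
    = (LINT x|lborel. poly q (h + 1 * x) * uspline c h p (i + 1) (h + 1 * x))"
    using lborel_integral_real_affine[of 1 "\<lambda>x. poly q x * uspline c h p (i + 1) x" h] by simp
  then show ?thesis
    using False uspline_shift[of c h p i]
    by (simp add: spline_integral_def poly_pcompose add.commute)
qed (simp add: spline_integral_def poly_pcompose algebra_simps)

section \<open>Moments up to order 2 and the spline variance\<close>

text \<open>The powers of \<open>x - t\<^sub>i\<close>, \<open>t\<^sub>i = c + i h\<close>, are written out as coefficient lists.\<close>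

lemma spline_integral_moments:
  fixes c h :: real and i p :: nat
  assumes "h > 0"
  defines "s \<equiv> c + real i * h"
  shows "spline_integral c h p i [:1:] = h"
    and "spline_integral c h p i [:- s, 1:] = h * (real p * h / 2)"
    and "spline_integral c h p i [:s\<^sup>2, - 2 * s, 1:] = h * ((real p * h / 2)\<^sup>2 + real p * h\<^sup>2 / 12)"
proof -
  let ?I = "\<lambda>p. spline_integral c h p i"
  note lin = spline_integral_add[OF assms(1)] spline_integral_smult
  \<comment> \<open>Here \<open>r\<close> is the forward difference of \<open>q\<close>, of lower
    degree than a nonconstant \<open>q\<close>. It is applied to \<open>q\<close> = (x - s)^(j+1) /
    (j+1), whose derivative is (x - s)^j, for j = 0, 1, 2.\<close>
  have step: "h * ?I (Suc p) (pderiv q) = ?I p r"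
    if "pcompose q [:h, 1:] = r + q" for p q r
    using spline_integral_pderiv[OF assms(1), of c p i q]
    unfolding spline_integral_shift that by (simp add: lin)
  have s0: "h * ?I (Suc p) [:1:] = h * ?I p [:1:]" for p
    using step[of "[:- s, 1:]" "smult h [:1:]" p]
    by (simp add: lin(2)[symmetric] pcompose_pCons pderiv_pCons)
  show m0: "?I p [:1:] = h" for p
  proof (induction p)
    case (Suc p)
    then show ?case using s0[of p] assms(1) by simp
  qed (simp add: spline_integral_def)
  have s1: "h * ?I (Suc p) [:- s, 1:] = ?I p (smult h [:- s, 1:] + smult (h\<^sup>2 / 2) [:1:])" for p
    using step[of "smult (1/2) [:s\<^sup>2, - 2 * s, 1:]" "smult h [:- s, 1:] + smult (h\<^sup>2 / 2) [:1:]" p]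
    by (simp add: pcompose_pCons pderiv_pCons algebra_simps power2_eq_square)
  show m1: "?I p [:- s, 1:] = h * (real p * h / 2)" for p
  proof (induction p)
    case (Suc p)
    have "h * ?I (Suc p) [:- s, 1:] = h * (h * (real (Suc p) * h / 2))"
      unfolding s1 lin Suc.IH m0 by (simp add: field_simps power2_eq_square)
    then show ?case using assms(1) by simp
  qed (simp add: spline_integral_def s_def)
  have s2: "h * ?I (Suc p) [:s\<^sup>2, - 2 * s, 1:]
    = ?I p (smult h [:s\<^sup>2, - 2 * s, 1:] + smult (h\<^sup>2) [:- s, 1:] + smult (h ^ 3 / 3) [:1:])" for p
    using step[of "smult (1/3) [:- (s ^ 3), 3 * s\<^sup>2, - 3 * s, 1:]"
        "smult h [:s\<^sup>2, - 2 * s, 1:] + smult (h\<^sup>2) [:- s, 1:] + smult (h ^ 3 / 3) [:1:]" p]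
    by (simp add: pcompose_pCons pderiv_pCons algebra_simps power2_eq_square power3_eq_cube)
  show "?I p [:s\<^sup>2, - 2 * s, 1:] = h * ((real p * h / 2)\<^sup>2 + real p * h\<^sup>2 / 12)" for p
  proof (induction p)
    case (Suc p)
    have "h * ?I (Suc p) [:s\<^sup>2, - 2 * s, 1:]
      = h * (h * ((real (Suc p) * h / 2)\<^sup>2 + real (Suc p) * h\<^sup>2 / 12))"
      unfolding s2 lin Suc.IH m0 m1 by (simp add: field_simps power2_eq_square power3_eq_cube)
    then show ?case using assms(1) by simp
  qed (simp add: spline_integral_def s_def algebra_simps power2_eq_square)
qed

lemma moment_2_normalized_bspline:
  assumes "h > 0" and "p \<ge> 1"
  shows "moment 2 (normalized_bspline p h) = real p * h\<^sup>2 / 12"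
proof -
  let ?a = "real p * h / 2"
  let ?I = "spline_integral (- ?a) h p 0"
  have B: "bspline p h = uspline (- ?a) h p 0"
    unfolding bspline_def equidistant_knots_def by simp
  note lin = spline_integral_add[OF assms(1)] spline_integral_smult
  note m = spline_integral_moments[OF assms(1), of "- ?a" p 0]
  have "moment 2 (normalized_bspline p h) = ?I [:0, 0, 1:] / h"
    using assms(2)
    by (simp add: moment_def normalized_bspline_def B spline_integral_def power2_eq_square)
  \<comment> \<open>With \<open>?a\<close> minus the first knot and y = x + a, this is x^2 = y^2 - 2
    a y + a^2. Since a is also the mean of y, the a^2 terms cancel and the variance remains.\<close>
  also have "[:0, 0, 1:] = [:?a\<^sup>2, 2 * ?a, 1:] + smult (- (2 * ?a)) [:?a, 1:] + smult (?a\<^sup>2) [:1:]"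
    by (simp add: power2_eq_square)
  also have "?I \<dots> / h = real p * h\<^sup>2 / 12"
    using m assms(1) unfolding lin by (simp add: field_simps power2_eq_square)
  finally show ?thesis .
qed

section \<open>Second moment and Fourier transform of the Gaussian, and the comparison\<close>

lemma moment_2_normal_density:
  assumes "\<sigma> > 0"
  shows "moment 2 (normal_density 0 \<sigma>) = \<sigma>\<^sup>2"
proof -
  have "moment 2 (normal_density 0 \<sigma>) = (LINT x|lborel. normal_density 0 \<sigma> x * (x - 0) ^ (2 * 1))"
    by (simp add: moment_def mult.commute)
  also have "\<dots> = fact (2 * 1) / ((2 / \<sigma>\<^sup>2) ^ 1 * fact 1)"
    by (rule has_bochner_integral_integral_eq[OF normal_moment_even[OF assms]])
  also have "\<dots> = \<sigma>\<^sup>2"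
    by simp
  finally show ?thesis .
qed

text \<open>Rescaling x by \<open>\<sigma>\<close> reduces to the characteristic function of the
  standard normal distribution, taken at \<open>- (\<sigma> * \<omega>)\<close> because the Fourier
  kernel has a negative exponent.\<close>

lemma fourier_normal_density:
  assumes "\<sigma> > 0"
  shows "fourier (normal_density 0 \<sigma>) \<omega> = complex_of_real (exp (- (\<sigma> * \<omega>)\<^sup>2 / 2))"
proof -
  have "fourier (normal_density 0 \<sigma>) \<omega>
    = \<sigma> *\<^sub>R (LINT x|lborel. complex_of_real (normal_density 0 \<sigma> (0 + \<sigma> * x))
        * exp (- (\<i> * complex_of_real \<omega> * complex_of_real (0 + \<sigma> * x))))"
    unfolding fourier_def using assms by (subst lborel_integral_real_affine[of \<sigma> _ 0]) auto
  also have "\<dots> = (LINT x|lborel. \<sigma> *\<^sub>R (complex_of_real (normal_density 0 \<sigma> (0 + \<sigma> * x))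
        * exp (- (\<i> * complex_of_real \<omega> * complex_of_real (0 + \<sigma> * x)))))"
    by simp
  also have "\<dots> = (LINT x|lborel. std_normal_density x *\<^sub>R iexp (- (\<sigma> * \<omega>) * x))"
  proof (rule Bochner_Integration.integral_cong[OF refl])
    fix x
    have "\<sigma> * normal_density 0 \<sigma> (\<sigma> * x) = std_normal_density x"
      using assms by (simp add: normal_density_def real_sqrt_mult power_mult_distrib)
    then have "\<sigma> *\<^sub>R complex_of_real (normal_density 0 \<sigma> (0 + \<sigma> * x))
        = complex_of_real (std_normal_density x)"
      by (metis add_0 of_real_mult scaleR_conv_of_real)
    moreover have "- (\<i> * complex_of_real \<omega> * complex_of_real (0 + \<sigma> * x))
        = \<i> * complex_of_real (- (\<sigma> * \<omega>) * x)"
      by simp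
    ultimately show "\<sigma> *\<^sub>R (complex_of_real (normal_density 0 \<sigma> (0 + \<sigma> * x))
        * exp (- (\<i> * complex_of_real \<omega> * complex_of_real (0 + \<sigma> * x))))
      = std_normal_density x *\<^sub>R iexp (- (\<sigma> * \<omega>) * x)"
      by (metis mult_scaleR_left scaleR_conv_of_real)
  qed
  also have "\<dots> = char std_normal_distribution (- (\<sigma> * \<omega>))"
    unfolding char_def by (subst integral_density) auto
  finally show ?thesis
    by (simp add: char_std_normal_distribution)
qed

theorem theorem3:
  fixes \<tau> k h \<alpha> \<sigma> :: real and p :: nat and \<rho> :: "real \<Rightarrow> real"
  assumes "\<tau> > 0" and "k > 0" and "p \<ge> 1"
    and "\<alpha> = sqrt (3 * real p) * \<tau> / k"
    and "h > 0" and "support (bspline p h) = {- \<alpha>..\<alpha>}"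
    and "\<sigma> > 0" and "\<rho> = normal_density 0 \<sigma>"
    and "\<And>j. j \<in> {0..3} \<Longrightarrow> moment j \<rho> = moment j (normalized_bspline p h)"
  shows "\<exists>\<sigma>\<^sub>\<omega>>0. (\<forall>\<omega>. fourier \<rho> \<omega> = complex_of_real (exp (- \<omega>\<^sup>2 / (2 * \<sigma>\<^sub>\<omega>\<^sup>2)))) \<and> k = \<tau> * \<sigma>\<^sub>\<omega>"
proof -
  have "real p * h / 2 = sqrt (3 * real p) * \<tau> / k"
    using support_bspline assms by metis
  then have "(real p * h / 2)\<^sup>2 = 3 * real p * (\<tau> / k)\<^sup>2"
    by (simp add: power_mult_distrib power_divide)
  \<comment> \<open>Dividing by 3 and splitting off one factor \<open>real p\<close> exposes the
    spline variance, so that cancelling \<open>real p\<close> identifies it.\<close>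
  then have "real p * (real p * h\<^sup>2 / 12) = real p * (\<tau> / k)\<^sup>2"
    by (simp add: power2_eq_square mult_ac)
  then have "real p * h\<^sup>2 / 12 = (\<tau> / k)\<^sup>2"
    using assms(3) by (simp only: mult_cancel_left) simp
  then have "\<sigma>\<^sup>2 = (\<tau> / k)\<^sup>2"
    using assms(9)[of 2] moment_2_normalized_bspline[OF assms(5,3)]
    by (simp add: assms(8) moment_2_normal_density[OF assms(7)])
  then have "\<sigma> = \<tau> / k"
    using assms by (simp add: power2_eq_iff_nonneg)
  then show ?thesis
    using assms(1,2,7)
    by (intro exI[of _ "k / \<tau>"])
       (auto simp: assms(8) fourier_normal_density power_mult_distrib power_divide field_simps)
qed

end
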